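(* Let the roundoffs $\delta_1,\ldots,\delta_{2n}$ in shifted general summation of $x_1,\ldots,x_n$ with shift $c$ be independent mean-zero random variables with $|\delta_k|\le u$. Let $h$ be the height of the computational tree in the inner call to general summation, and $\lambda\equiv\sqrt{2\ln(2(2n+1)/\eta)}$. For any $\eta>0$ with $\lambda\sqrt{h+2}\,u<1$ and any $\delta\in(0,1)$, with probability at least $1-(\delta+\eta)$, the error in shifted general summation is bounded by $$|\hat{s}_n-s_n|\le u\,\exp(\lambda\sqrt{h+2}\,u)\left(s_n^2+\sum_{k=2}^n t_k^2+\sum_{k=1}^n y_k^2\right)^{1/2}\sqrt{2\ln(2/\delta)}.$$
   Context: General summation of real numbers $y_1,\ldots,y_n$ ($n\ge 2$): start with the multiset $\mathcal{S}=\{y_1,\ldots,y_n\}$; for $k=2,\ldots,n$ remove two elements $a,b$ from $\mathcal{S}$, set $t_k=a+b$, and add $t_k$ to $\mathcal{S}$; the output is $t_n=\sum_i y_i$. The order of summation is fixed in advance. Its computational tree is the binary tree with leaves $y_1,\ldots,y_n$ and internal vertices $t_2,\ldots,t_n$ (root $t_n$), the children of $t_k$ being the two elements $a,b$ with $t_k=a+b$; the height $h$ is the length of the longest downward path from the root to a leaf. Shifted general summation of real numbers $x_1,\ldots,x_n$ with shift $c$: compute $y_k=x_k-c$ for $1\le k\le n$; compute $t_n$ by general summation applied to $y_1,\ldots,y_n$ (inner call), with exact partial sums $t_2,\ldots,t_n$; return $s_n=t_n+nc=\sum_k x_k$. This is regarded as a general summation of the $2n+1$ inputs $x_1,-c,x_2,-c,\ldots,x_n,-c,nc$,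 all stored exactly (in particular $nc$ is an exact input), with a tree of height $h+2$. Floating point model (unit roundoff $0<u<1$, no overflow or underflow): each of the $2n$ additions (the $n$ shifts $y_k=x_k+(-c)$, the $n-1$ sums $t_k$, and the final sum $t_n+nc$) is performed on the computed operands and the result is multiplied by $1+\delta_i$ with $|\delta_i|\le u$: $\hat{y}_k=(x_k-c)(1+\delta_k)$ for $1\le k\le n$, $\hat{t}_k=(\hat{a}+\hat{b})(1+\delta_{n+k-1})$ for $2\le k\le n$ (where $\hat a,\hat b$ are the computed values of the children of $t_k$), and $\hat{s}_n=(\hat{t}_n+nc)(1+\delta_{2n})$. The $x_k$ and $c$ are deterministic; $y_k,t_k,s_n$ without hats are exact values. *)

theory Defs
  imports "HOL-Probability.Probability"
begin

text \<open>
  The elements of the evolving multiset are named by the vertices of the computational tree: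
  \<open>Inp i\<close> is the \<open>i\<close>-th input and \<open>Psum k\<close> the partial sum \<open>t\<^sub>k\<close>.
  Working with names instead of values keeps repeated values apart and makes the order of summation
  independent of the data.  A schedule maps each step \<open>k = 2, \<dots>, n\<close>
  to the two elements that are added to form \<open>t\<^sub>k\<close>.
\<close>

datatype vertex = Inp nat | Psum nat

type_synonym schedule = "nat \<Rightarrow> vertex \<times> vertex"

text \<open>\<open>pool n \<sigma> j\<close> is the multiset after the \<open>j\<close> steps \<open>2, \<dots>, j + 1\<close>.\<close>

primrec pool :: "nat \<Rightarrow> schedule \<Rightarrow> nat \<Rightarrow> vertex set" where
  "pool n \<sigma> 0 = Inp ` {1..n}"
| "pool n \<sigma> (Suc j) =
     insert (Psum (j + 2)) (pool n \<sigma> j - {fst (\<sigma> (j + 2)), snd (\<sigma> (j + 2))})"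

definition valid_schedule :: "nat \<Rightarrow> schedule \<Rightarrow> bool" where
  "valid_schedule n \<sigma> \<longleftrightarrow>
     (\<forall>k\<in>{2..n}. fst (\<sigma> k) \<noteq> snd (\<sigma> k)
               \<and> fst (\<sigma> k) \<in> pool n \<sigma> (k - 2) \<and> snd (\<sigma> k) \<in> pool n \<sigma> (k - 2))"

text \<open>
  Running the schedule on inputs \<open>y\<close>; \<open>add k\<close> is the (exact or rounded) addition used in step \<open>k\<close>.
  The value \<open>0\<close> of partial sums that have not been formed yet is a dummy.
\<close>

primrec run ::
  "(nat \<Rightarrow> real \<Rightarrow> real \<Rightarrow> real) \<Rightarrow> schedule \<Rightarrow> (nat \<Rightarrow> real) \<Rightarrow> nat \<Rightarrow> vertex \<Rightarrow> real" where
  "run add \<sigma> y 0 = (\<lambda>v. case v of Inp i \<Rightarrow> y i | Psum k \<Rightarrow> 0)"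
| "run add \<sigma> y (Suc j) = (run add \<sigma> y j)
     (Psum (j + 2) := add (j + 2) (run add \<sigma> y j (fst (\<sigma> (j + 2))))
                                  (run add \<sigma> y j (snd (\<sigma> (j + 2)))))"

definition vertex_value ::
  "(nat \<Rightarrow> real \<Rightarrow> real \<Rightarrow> real) \<Rightarrow> nat \<Rightarrow> schedule \<Rightarrow> (nat \<Rightarrow> real) \<Rightarrow> vertex \<Rightarrow> real" where
  "vertex_value add n \<sigma> y = run add \<sigma> y (n - 1)"

definition children :: "nat \<Rightarrow> schedule \<Rightarrow> (vertex \<times> vertex) set" where
  "children n \<sigma> = {(Psum k, v) | k v. k \<in> {2..n} \<and> (v = fst (\<sigma> k) \<or> v = snd (\<sigma> k))}"

definition tree_height :: "nat \<Rightarrow> schedule \<Rightarrow> nat" where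
  "tree_height n \<sigma> = Max {m. \<exists>i\<in>{1..n}. (Psum n, Inp i) \<in> children n \<sigma> ^^ m}"

lemma run_Inp: "run add \<sigma> y j (Inp i) = y i"
  by (induction j) auto

lemma run_Psum_stable:
  assumes "j \<le> m" "k \<le> j + 1"
  shows "run add \<sigma> y m (Psum k) = run add \<sigma> y j (Psum k)"
  using assms by (induction m rule: dec_induct) auto

lemma pool_subset: "pool n \<sigma> j \<subseteq> Inp ` {1..n} \<union> Psum ` {2..j + 1}"
  by (induction j) auto

lemma run_pool:
  assumes "v \<in> pool n \<sigma> j" "j \<le> m"
  shows "run add \<sigma> y m v = run add \<sigma> y j v"
proof -
  consider i where "v = Inp i" | k where "v = Psum k" "k \<le> j + 1"
    using pool_subset[of n \<sigma> j] assms(1) by auto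
  then show ?thesis
    using assms(2) run_Inp run_Psum_stable by cases (auto simp: run_Inp intro: run_Psum_stable)
qed

lemma vertex_value_Inp: "vertex_value add n \<sigma> y (Inp i) = y i"
  by (simp add: vertex_value_def run_Inp)

lemma vertex_value_Psum:
  assumes "valid_schedule n \<sigma>" "k \<in> {2..n}"
  shows "vertex_value add n \<sigma> y (Psum k) =
           add k (vertex_value add n \<sigma> y (fst (\<sigma> k))) (vertex_value add n \<sigma> y (snd (\<sigma> k)))"
proof -
  define j where "j = k - 2"
  have j: "k = j + 2" "j + 1 \<le> n - 1"
    using assms(2) by (auto simp: j_def)
  have "fst (\<sigma> k) \<in> pool n \<sigma> j" "snd (\<sigma> k) \<in> pool n \<sigma> j"
    using assms by (auto simp: valid_schedule_def j_def)
  moreover have "run add \<sigma> y (n - 1) (Psum k) = run add \<sigma> y (Suc j) (Psum k)"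
    using j by (intro run_Psum_stable) auto
  ultimately show ?thesis
    using j run_pool[of _ n \<sigma> j "n - 1" add y] by (simp add: vertex_value_def)
qed

definition shifted_y :: "(nat \<Rightarrow> real) \<Rightarrow> real \<Rightarrow> nat \<Rightarrow> real" where
  "shifted_y x c k = x k - c"

definition shifted_t :: "nat \<Rightarrow> schedule \<Rightarrow> (nat \<Rightarrow> real) \<Rightarrow> real \<Rightarrow> nat \<Rightarrow> real" where
  "shifted_t n \<sigma> x c k = vertex_value (\<lambda>_ a b. a + b) n \<sigma> (shifted_y x c) (Psum k)"

definition shifted_s :: "nat \<Rightarrow> schedule \<Rightarrow> (nat \<Rightarrow> real) \<Rightarrow> real \<Rightarrow> real" where
  "shifted_s n \<sigma> x c = shifted_t n \<sigma> x c n + real n * c"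

text \<open>
  In the computed values, \<open>e 1, \<dots>, e n\<close> are the roundoffs of the shifts, \<open>e (n + k - 1)\<close> that of
  \<open>t\<^sub>k\<close>, and \<open>e (2 * n)\<close> that of the final addition; \<open>real n * c\<close> is stored exactly.
\<close>

definition fl_shifted_y :: "(nat \<Rightarrow> real) \<Rightarrow> (nat \<Rightarrow> real) \<Rightarrow> real \<Rightarrow> nat \<Rightarrow> real" where
  "fl_shifted_y e x c k = (x k - c) * (1 + e k)"

definition fl_shifted_t ::
  "(nat \<Rightarrow> real) \<Rightarrow> nat \<Rightarrow> schedule \<Rightarrow> (nat \<Rightarrow> real) \<Rightarrow> real \<Rightarrow> nat \<Rightarrow> real" where
  "fl_shifted_t e n \<sigma> x c k =
     vertex_value (\<lambda>k a b. (a + b) * (1 + e (n + k - 1))) n \<sigma> (fl_shifted_y e x c) (Psum k)"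

definition fl_shifted_s ::
  "(nat \<Rightarrow> real) \<Rightarrow> nat \<Rightarrow> schedule \<Rightarrow> (nat \<Rightarrow> real) \<Rightarrow> real \<Rightarrow> real" where
  "fl_shifted_s e n \<sigma> x c = (fl_shifted_t e n \<sigma> x c n + real n * c) * (1 + e (2 * n))"

end

theory Submission
  imports Defs
begin

text \<open>
  A roundoff committed in one operation travels to the root of the computational tree, where it
  is multiplied by \<open>1 + \<delta>\<^sub>k\<close> in each operation \<open>k\<close> above it and by nothing else.  Hence the error is
  exactly \<open>\<Sum>\<^sub>i \<delta>\<^sub>i a\<^sub>i P\<^sub>i\<close>, where \<open>a\<^sub>i\<close> is the exact result of operation \<open>i\<close> and \<open>P\<^sub>i\<close> is the product
  of \<open>1 + \<delta>\<^sub>k\<close> over the operations above \<open>i\<close> (lemma \<open>shifted_error_expansion\<close>).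

  The operations above \<open>i\<close> have larger numbers than \<open>i\<close>.  So, if the roundoffs are revealed from the
  last one to the first one, the factor of \<open>\<delta>\<^sub>i\<close> is known before \<open>\<delta>\<^sub>i\<close> is revealed, and the error is the
  final value of a martingale.  An inequality of Azuma-Hoeffding type applies once \<open>P\<^sub>i\<close> is bounded
  (lemma \<open>martingale_tail\<close>).

  The products are bounded with high probability: \<open>P\<^sub>i \<le> exp (\<Sum>\<^sub>k \<delta>\<^sub>k)\<close>, and the sum has at most \<open>h + 1\<close>
  independent terms, so that it exceeds \<open>lam * sqrt (h + 2) * u\<close> with probability at most
  \<open>exp (- lam\<^sup>2 / 2) = \<eta> / (2 * (2 * n + 1))\<close>.  All \<open>2 * n\<close> exceptional events together have probability
  at most \<open>\<eta>\<close>.  Replacing \<open>P\<^sub>i\<close> by \<open>0\<close> where it is too large keeps the martingale structure and makes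
  all increments bounded; the two-sided tail bound for the truncated martingale contributes \<open>p\<close>, and
  the truncation changes nothing outside the exceptional events (lemma \<open>propagated_error_tail\<close>).
\<close>

section \<open>Concentration for martingales built from bounded roundoffs\<close>

text \<open>
  The auxiliary function in the proof of Hoeffding's lemma, taken for the symmetric distribution on
  two points (weight \<open>1 / 2\<close>, argument \<open>2 * x\<close>), is \<open>ln (cosh x)\<close>.
\<close>

lemma cosh_le_exp_half_square: "cosh x \<le> exp (x\<^sup>2 / 2)" for x :: real
proof -
  have pos: "cosh y \<le> exp (y\<^sup>2 / 2)" if "y \<ge> 0" for y :: real
  proof -
    have eq: "1 + 1/2 * (exp (2 * y) - 1) = exp y * cosh y"
      by (simp add: cosh_field_def algebra_simps flip: exp_add)
    have "- (2 * y) * (1/2) + ln (1 + 1/2 * (exp (2 * y) - 1)) \<le> (2 * y)\<^sup>2 / 8"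
      using that by (intro Hoeffdings_lemma_aux) auto
    then have "ln (cosh y) \<le> y\<^sup>2 / 2"
      unfolding eq by (simp add: ln_mult cosh_real_pos power_mult_distrib)
    then show ?thesis
      by (subst exp_ln[of "cosh y", symmetric]) (simp_all only: exp_le_cancel_iff cosh_real_pos)
  qed
  show ?thesis
    using pos[of x] pos[of "- x"] by (cases "x \<ge> 0") auto
qed

text \<open>
  By convexity the exponential lies below its chord over \<open>[- u g, u g]\<close>.  The bound is affine in \<open>d\<close>,
  so its expectation for random \<open>d\<close> of mean zero is \<open>cosh (u g)\<close>.
\<close>

lemma exp_mult_le_chord:
  fixes d g u :: real
  assumes "\<bar>d\<bar> \<le> u" "0 < u"
  shows "exp (d * g) \<le> cosh (u * g) + d * (sinh (u * g) / u)"
proof -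
  \<comment> \<open>The weight of \<open>u\<close> when \<open>d\<close> is written as a convex combination of \<open>- u\<close> and \<open>u\<close>.\<close>
  define t where "t = (u + d) / (2 * u)"
  have t: "0 \<le> t" "t \<le> 1"
    using assms by (auto simp: t_def field_simps)
  have "t * (u * g) + (1 - t) * - (u * g) = u * g * (2 * t - 1)"
    by (simp add: algebra_simps)
  also have "2 * t - 1 = d / u"
    using assms(2) by (simp add: t_def field_simps)
  finally have comb: "(1 - t) * - (u * g) + t * (u * g) = d * g"
    using assms(2) by simp
  have "exp (d * g) \<le> (1 - t) * exp (- (u * g)) + t * exp (u * g)"
    using convex_onD[OF convex_on_exp[of 1], of t "- (u * g)" "u * g"] t comb by simp
  also have "\<dots> = cosh (u * g) + (2 * t - 1) * sinh (u * g)"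
    unfolding cosh_field_def sinh_field_def by (simp add: field_simps)
  also have "(2 * t - 1) * sinh (u * g) = d * (sinh (u * g) / u)"
    using assms(2) by (simp add: t_def field_simps)
  finally show ?thesis .
qed

locale bounded_roundoffs = prob_space M for M :: "'w measure" +
  fixes \<delta> :: "nat \<Rightarrow> 'w \<Rightarrow> real" and N :: nat and u :: real
  assumes u_pos: "0 < u"
    and indep: "indep_vars (\<lambda>_. borel) \<delta> {1..N}"
    and mean_zero: "k \<in> {1..N} \<Longrightarrow> expectation (\<delta> k) = 0"
    and AE_le: "k \<in> {1..N} \<Longrightarrow> AE \<omega> in M. \<bar>\<delta> k \<omega>\<bar> \<le> u"
begin

text \<open>
  The history at the moment when \<open>\<delta>\<^sub>j\<close> is revealed, the roundoffs being revealed from the last one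
  to the first one.
\<close>

definition later :: "nat \<Rightarrow> 'w \<Rightarrow> nat \<Rightarrow> real" where
  "later j \<omega> = restrict (\<lambda>k. \<delta> k \<omega>) {j<..N}"

lemma measurable_roundoff: "k \<in> {1..N} \<Longrightarrow> random_variable borel (\<delta> k)"
  using indep by (auto simp: indep_vars_def)

lemma measurable_later: "later j \<in> M \<rightarrow>\<^sub>M Pi\<^sub>M {j<..N} (\<lambda>_. borel)"
  unfolding later_def by (intro measurable_restrict measurable_roundoff) auto

lemma AE_all_le: "AE \<omega> in M. \<forall>k\<in>{1..N}. \<bar>\<delta> k \<omega>\<bar> \<le> u"
  using AE_le by (intro AE_finite_allI) auto

lemma restrict_later: "j \<le> i \<Longrightarrow> restrict (later j \<omega>) {i<..N} = later i \<omega>"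
  by (auto simp: later_def restrict_def fun_eq_iff)

text \<open>
  The martingale property, stated without conditional expectations: a roundoff is orthogonal to
  every integrable function of the roundoffs revealed before it.
\<close>

lemma expectation_mult_later_eq_0:
  assumes k: "k \<in> {1..N}" and F: "F \<in> borel_measurable (Pi\<^sub>M {k<..N} (\<lambda>_. borel))"
    and int: "integrable M (\<lambda>\<omega>. F (later k \<omega>))"
  shows "integrable M (\<lambda>\<omega>. \<delta> k \<omega> * F (later k \<omega>))"
    and "expectation (\<lambda>\<omega>. \<delta> k \<omega> * F (later k \<omega>)) = (0 :: real)"
proof -
  have "indep_var (Pi\<^sub>M {k} (\<lambda>_. borel)) (\<lambda>\<omega>. restrict (\<lambda>i. \<delta> i \<omega>) {k})
                  (Pi\<^sub>M {k<..N} (\<lambda>_. borel)) (later k)"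
    unfolding later_def using k by (intro indep_var_restrict[OF indep]) auto
  then have "indep_var borel ((\<lambda>e. e k) \<circ> (\<lambda>\<omega>. restrict (\<lambda>i. \<delta> i \<omega>) {k})) borel (F \<circ> later k)"
    by (rule indep_var_compose) (auto intro: F)
  then have ind: "indep_var borel (\<delta> k) borel (\<lambda>\<omega>. F (later k \<omega>))"
    by (simp add: comp_def)
  have "integrable M (\<delta> k)"
    using AE_le[OF k] measurable_roundoff[OF k] by (intro integrable_const_bound[of _ u]) auto
  from indep_var_integrable[OF ind this int] indep_var_lebesgue_integral[OF ind this int]
  show "integrable M (\<lambda>\<omega>. \<delta> k \<omega> * F (later k \<omega>))"
    and "expectation (\<lambda>\<omega>. \<delta> k \<omega> * F (later k \<omega>)) = (0 :: real)"
    using mean_zero[OF k] by simp_all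
qed

text \<open>
  The roundoffs are integrated out one by one, from the first index to the last.  Bounding the
  exponential of the increment \<open>\<delta>\<^sub>i G\<^sub>i\<close> by its chord leaves a term linear in \<open>\<delta>\<^sub>i\<close>, which has expectation
  zero, and the factor \<open>cosh (u G\<^sub>i) \<le> exp (u\<^sup>2 B\<^sub>i\<^sup>2 / 2)\<close>.
\<close>

lemma exp_moment_bound:
  fixes G :: "nat \<Rightarrow> (nat \<Rightarrow> real) \<Rightarrow> real" and B :: "nat \<Rightarrow> real"
  defines "S \<equiv> \<lambda>\<omega>. \<Sum>i = 1..N. \<delta> i \<omega> * G i (later i \<omega>)"
  assumes meas: "\<And>i. i \<in> {1..N} \<Longrightarrow> G i \<in> borel_measurable (Pi\<^sub>M {i<..N} (\<lambda>_. borel))"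
    and bound: "\<And>i e. i \<in> {1..N} \<Longrightarrow> \<bar>G i e\<bar> \<le> B i"
  shows "integrable M (\<lambda>\<omega>. exp (S \<omega>))"
    and "expectation (\<lambda>\<omega>. exp (S \<omega>)) \<le> exp (u\<^sup>2 * (\<Sum>i = 1..N. (B i)\<^sup>2) / 2)"
proof -
  \<comment> \<open>The part of the sum that is determined by the history at time \<open>j\<close>, as a function of it.\<close>
  define T where "T j e = (\<Sum>i\<in>{j<..N}. e i * G i (restrict e {i<..N}))" for j and e :: "nat \<Rightarrow> real"
  have T_later: "T j (later j \<omega>) = (\<Sum>i\<in>{j<..N}. \<delta> i \<omega> * G i (later i \<omega>))" for j \<omega>
    unfolding T_def by (intro sum.cong) (auto simp: restrict_later, simp add: later_def)
  have T_meas: "T j \<in> borel_measurable (Pi\<^sub>M {j<..N} (\<lambda>_. borel))" for j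
    unfolding T_def
  proof (intro borel_measurable_sum borel_measurable_times)
    fix i assume i: "i \<in> {j<..N}"
    then show "(\<lambda>e. e i) \<in> borel_measurable (Pi\<^sub>M {j<..N} (\<lambda>_. borel :: real measure))"
      by (rule measurable_component_singleton)
    have "(\<lambda>e. restrict e {i<..N}) \<in> Pi\<^sub>M {j<..N} (\<lambda>_. borel) \<rightarrow>\<^sub>M Pi\<^sub>M {i<..N} (\<lambda>_. borel :: real measure)"
      using i by (intro measurable_restrict_subset) auto
    then show "(\<lambda>e. G i (restrict e {i<..N})) \<in> borel_measurable (Pi\<^sub>M {j<..N} (\<lambda>_. borel))"
      using i by (intro measurable_compose[OF _ meas]) auto
  qed
  have T_bound: "AE \<omega> in M. \<bar>T j (later j \<omega>)\<bar> \<le> u * (\<Sum>i\<in>{j<..N}. B i)" for j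
    using AE_all_le
  proof eventually_elim
    case (elim \<omega>)
    have "\<bar>T j (later j \<omega>)\<bar> \<le> (\<Sum>i\<in>{j<..N}. \<bar>\<delta> i \<omega>\<bar> * \<bar>G i (later i \<omega>)\<bar>)"
      unfolding T_later abs_mult[symmetric] by (rule sum_abs)
    also have "\<dots> \<le> (\<Sum>i\<in>{j<..N}. u * B i)"
      using elim u_pos by (intro sum_mono mult_mono bound) auto
    finally show ?case
      by (simp add: sum_distrib_left)
  qed
  have T_int: "integrable M (\<lambda>\<omega>. exp (T j (later j \<omega>)))" for j
  proof (rule integrable_const_bound)
    show "AE \<omega> in M. norm (exp (T j (later j \<omega>))) \<le> exp (u * (\<Sum>i\<in>{j<..N}. B i))"
      using T_bound[of j] by eventually_elim auto
    show "random_variable borel (\<lambda>\<omega>. exp (T j (later j \<omega>)))"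
      using measurable_compose[OF measurable_later T_meas] by measurable
  qed
  have main: "expectation (\<lambda>\<omega>. exp (T j (later j \<omega>))) \<le> exp (u\<^sup>2 * (\<Sum>i\<in>{j<..N}. (B i)\<^sup>2) / 2)"
    if "j \<le> N" for j
    using that
  proof (induction rule: inc_induct)
    case base
    then show ?case by (simp add: T_def prob_space)
  next
    case (step j)
    let ?k = "Suc j"
    have k: "?k \<in> {1..N}" using step by auto
    have ins: "{j<..N} = insert ?k {?k<..N}" using step by auto
    define E g where "E = (\<lambda>e. exp (T ?k e))" and "g = (\<lambda>e. u * G ?k e)"
    have split: "exp (T j (later j \<omega>)) = E (later ?k \<omega>) * exp (\<delta> ?k \<omega> * G ?k (later ?k \<omega>))" for \<omega>
      unfolding T_later E_def ins by (simp add: exp_add mult.commute)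
    have g_bound: "\<bar>g e\<bar> \<le> u * B ?k" for e
      using bound[OF k] u_pos by (simp add: g_def abs_mult)
    have E_int: "integrable M (\<lambda>\<omega>. E (later ?k \<omega>))"
      unfolding E_def by (rule T_int)
    have E_meas: "E \<in> borel_measurable (Pi\<^sub>M {?k<..N} (\<lambda>_. borel))"
      unfolding E_def using T_meas by measurable
    have g_meas: "g \<in> borel_measurable (Pi\<^sub>M {?k<..N} (\<lambda>_. borel))"
      unfolding g_def using meas[OF k] by simp
    \<comment> \<open>Needed for both \<open>cosh\<close> and \<open>sinh\<close>.\<close>
    have prod_int: "integrable M (\<lambda>\<omega>. E (later ?k \<omega>) * f (g (later ?k \<omega>)))"
      if f: "f \<in> borel_measurable borel" "\<And>y. \<bar>f y\<bar> \<le> cosh y" for f :: "real \<Rightarrow> real"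
    proof (rule Bochner_Integration.integrable_bound[OF integrable_mult_left[OF E_int, of "cosh (u * B ?k)"]])
      show "random_variable borel (\<lambda>\<omega>. E (later ?k \<omega>) * f (g (later ?k \<omega>)))"
        by (intro borel_measurable_times measurable_compose[OF measurable_later E_meas]
              measurable_compose[OF measurable_compose[OF measurable_later g_meas] f(1)])
      have "\<bar>f (g e)\<bar> \<le> cosh (u * B ?k)" for e
        using order_trans[OF f(2), of "g e" "cosh (u * B ?k)"] g_bound[of e]
          cosh_real_nonneg_le_iff[of "\<bar>g e\<bar>" "u * B ?k"] by (simp add: order_trans[OF abs_ge_zero])
      then show "AE \<omega> in M. norm (E (later ?k \<omega>) * f (g (later ?k \<omega>))) \<le> norm (E (later ?k \<omega>) * cosh (u * B ?k))"
        by (auto simp: abs_mult E_def)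
    qed
    have cosh_int: "integrable M (\<lambda>\<omega>. E (later ?k \<omega>) * cosh (g (later ?k \<omega>)))"
      by (rule prod_int) (auto simp: cosh_field_def)
    have sinh_le: "\<bar>sinh y\<bar> \<le> cosh y" for y :: real
    proof -
      have "\<bar>exp y - exp (- y)\<bar> \<le> exp y + exp (- y)"
        using exp_gt_zero[of y] exp_gt_zero[of "- y"] by linarith
      then show ?thesis
        by (simp add: sinh_field_def cosh_field_def)
    qed
    have sinh_int: "integrable M (\<lambda>\<omega>. E (later ?k \<omega>) * sinh (g (later ?k \<omega>)))"
      using sinh_le by (intro prod_int) (auto simp: sinh_field_def)
    define F where "F = (\<lambda>e. E e * (sinh (g e) / u))"
    have F_meas: "F \<in> borel_measurable (Pi\<^sub>M {?k<..N} (\<lambda>_. borel))"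
      unfolding F_def sinh_field_def using E_meas g_meas by measurable
    have F_int: "integrable M (\<lambda>\<omega>. F (later ?k \<omega>))"
      using integrable_divide[OF sinh_int, of u] by (simp add: F_def)
    note zero = expectation_mult_later_eq_0[OF k F_meas F_int]
    have "expectation (\<lambda>\<omega>. exp (T j (later j \<omega>)))
        \<le> expectation (\<lambda>\<omega>. E (later ?k \<omega>) * cosh (g (later ?k \<omega>)) + \<delta> ?k \<omega> * F (later ?k \<omega>))"
    proof (rule integral_mono_AE[OF T_int Bochner_Integration.integrable_add[OF cosh_int zero(1)]])
      show "AE \<omega> in M. exp (T j (later j \<omega>))
          \<le> E (later ?k \<omega>) * cosh (g (later ?k \<omega>)) + \<delta> ?k \<omega> * F (later ?k \<omega>)"
        using AE_le[OF k]
      proof eventually_elim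
        case (elim \<omega>)
        have "E (later ?k \<omega>) * exp (\<delta> ?k \<omega> * G ?k (later ?k \<omega>))
           \<le> E (later ?k \<omega>) * (cosh (g (later ?k \<omega>)) + \<delta> ?k \<omega> * (sinh (g (later ?k \<omega>)) / u))"
          unfolding g_def using elim u_pos by (intro mult_left_mono exp_mult_le_chord) (auto simp: E_def)
        then show ?case
          unfolding split by (simp add: F_def algebra_simps)
      qed
    qed
    also have "\<dots> = expectation (\<lambda>\<omega>. E (later ?k \<omega>) * cosh (g (later ?k \<omega>)))"
      by (simp add: Bochner_Integration.integral_add[OF cosh_int zero(1)] zero(2))
    also have "\<dots> \<le> expectation (\<lambda>\<omega>. E (later ?k \<omega>) * exp ((u * B ?k)\<^sup>2 / 2))"
    proof (rule integral_mono[OF cosh_int integrable_mult_left[OF E_int]])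
      fix \<omega>
      have "(g (later ?k \<omega>))\<^sup>2 \<le> (u * B ?k)\<^sup>2"
        using power_mono[OF g_bound, of "later ?k \<omega>" 2] by simp
      then show "E (later ?k \<omega>) * cosh (g (later ?k \<omega>)) \<le> E (later ?k \<omega>) * exp ((u * B ?k)\<^sup>2 / 2)"
        by (intro mult_left_mono order_trans[OF cosh_le_exp_half_square]) (auto simp: E_def)
    qed
    also have "\<dots> \<le> exp (u\<^sup>2 * (\<Sum>i\<in>{?k<..N}. (B i)\<^sup>2) / 2) * exp ((u * B ?k)\<^sup>2 / 2)"
      using step.IH by (simp add: E_def)
    also have "\<dots> = exp (u\<^sup>2 * (\<Sum>i\<in>{j<..N}. (B i)\<^sup>2) / 2)"
      unfolding ins by (simp add: exp_add[symmetric] field_simps)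
    finally show ?case .
  qed
  have eq: "{0<..N} = {1..N}" by auto
  show "integrable M (\<lambda>\<omega>. exp (S \<omega>))"
    using T_int[of 0] unfolding T_later eq S_def .
  show "expectation (\<lambda>\<omega>. exp (S \<omega>)) \<le> exp (u\<^sup>2 * (\<Sum>i = 1..N. (B i)\<^sup>2) / 2)"
    using main[of 0] unfolding T_later eq S_def by simp
qed


text \<open>
  The Azuma-Hoeffding inequality, normalised so that the deviation is \<open>r\<close> times the bound on the
  standard deviation.  In this form it remains meaningful when all bounds \<open>B\<^sub>i\<close> vanish.
\<close>

lemma martingale_tail:
  fixes G :: "nat \<Rightarrow> (nat \<Rightarrow> real) \<Rightarrow> real" and B :: "nat \<Rightarrow> real"
  defines "S \<equiv> \<lambda>\<omega>. \<Sum>i = 1..N. \<delta> i \<omega> * G i (later i \<omega>)"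
  assumes meas: "\<And>i. i \<in> {1..N} \<Longrightarrow> G i \<in> borel_measurable (Pi\<^sub>M {i<..N} (\<lambda>_. borel))"
    and bound: "\<And>i e. i \<in> {1..N} \<Longrightarrow> \<bar>G i e\<bar> \<le> B i"
    and r: "0 \<le> r"
  shows "prob {\<omega> \<in> space M. S \<omega> > u * sqrt (\<Sum>i = 1..N. (B i)\<^sup>2) * r} \<le> exp (- r\<^sup>2 / 2)"
proof -
  define V where "V = (\<Sum>i = 1..N. (B i)\<^sup>2)"
  have V0: "0 \<le> V" by (simp add: V_def sum_nonneg)
  consider "V = 0" | "V > 0" "r = 0" | "V > 0" "r > 0"
    using V0 r by linarith
  then show ?thesis
  proof cases
    case 1
    then have "B i = 0" if "i \<in> {1..N}" for i
      using that by (simp add: V_def sum_nonneg_eq_0_iff)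
    then have S0: "S \<omega> = 0" for \<omega>
      unfolding S_def using bound by (intro sum.neutral) (metis abs_le_zero_iff mult_zero_right)
    show ?thesis
      unfolding V_def[symmetric] 1 S0 by simp
  next
    case 2
    then show ?thesis by simp
  next
    case 3
    \<comment> \<open>The minimiser of the exponent \<open>- s * (u * sqrt V * r) + s\<^sup>2 * u\<^sup>2 * V / 2\<close>.\<close>
    define s where "s = r / (u * sqrt V)"
    have s: "s > 0" using 3 u_pos by (simp add: s_def)
    have eq: "(\<Sum>i = 1..N. \<delta> i \<omega> * (s * G i (later i \<omega>))) = s * S \<omega>" for \<omega>
      by (simp add: S_def sum_distrib_left mult_ac)
    have meas': "(\<lambda>e. s * G i e) \<in> borel_measurable (Pi\<^sub>M {i<..N} (\<lambda>_. borel))" if "i \<in> {1..N}" for i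
      using meas[OF that] by measurable
    have bound': "\<bar>s * G i e\<bar> \<le> s * B i" if "i \<in> {1..N}" for i e
      using bound[OF that, of e] s by (simp add: abs_mult)
    note exp_S = exp_moment_bound[where G = "\<lambda>i e. s * G i e" and B = "\<lambda>i. s * B i", OF meas' bound', unfolded eq]
    \<comment> \<open>Chernoff's bound is stated for the weak inequality.\<close>
    have "prob {\<omega> \<in> space M. S \<omega> > u * sqrt V * r} \<le> prob {\<omega> \<in> space M. S \<omega> \<ge> u * sqrt V * r}"
    proof (rule finite_measure_mono)
      have "random_variable borel (\<lambda>\<omega>. exp (s * S \<omega>))"
        using exp_S(1) by simp
      then have "random_variable borel (\<lambda>\<omega>. ln (exp (s * S \<omega>)) / s)"
        by measurable
      then have "random_variable borel S"
        using s by simp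
      then show "{\<omega> \<in> space M. S \<omega> \<ge> u * sqrt V * r} \<in> events"
        by measurable
    qed auto
    also have "\<dots> \<le> exp (- s * (u * sqrt V * r)) * (\<integral>\<omega>\<in>space M. exp (s * S \<omega>) \<partial>M)"
    proof (intro Chernoff_ineq_ge s)
      show "set_integrable M (space M) (\<lambda>\<omega>. exp (s * S \<omega>))"
        unfolding set_integrable_def by (rule integrable_mult_indicator[OF sets.top exp_S(1)])
    qed simp
    also have "(\<integral>\<omega>\<in>space M. exp (s * S \<omega>) \<partial>M) = expectation (\<lambda>\<omega>. exp (s * S \<omega>))"
      unfolding set_lebesgue_integral_def by (intro Bochner_Integration.integral_cong) auto
    also have "exp (- s * (u * sqrt V * r)) * \<dots> \<le> exp (- s * (u * sqrt V * r)) * exp (u\<^sup>2 * (\<Sum>i = 1..N. (s * B i)\<^sup>2) / 2)"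
      using exp_S(2) by (intro mult_left_mono) auto
    also have "(\<Sum>i = 1..N. (s * B i)\<^sup>2) = s\<^sup>2 * V"
      by (simp add: V_def sum_distrib_left power_mult_distrib)
    also have "exp (- s * (u * sqrt V * r)) * exp (u\<^sup>2 * (s\<^sup>2 * V) / 2) = exp (- r\<^sup>2 / 2)"
    proof -
      have "s * (u * sqrt V * r) = r\<^sup>2"
        using 3 u_pos by (simp add: s_def power2_eq_square)
      moreover have "u\<^sup>2 * (s\<^sup>2 * V) = r\<^sup>2"
        using 3 u_pos by (simp add: s_def power_divide power_mult_distrib)
      ultimately show ?thesis
        by (simp add: exp_add[symmetric])
    qed
    finally show ?thesis
      by (simp only: V_def)
  qed
qed

text \<open>
  Hoeffding's inequality is the case of the martingale bound with deterministic factors \<open>0\<close> and \<open>1\<close>.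
\<close>

lemma sum_tail:
  assumes A: "A \<subseteq> {1..N}" "card A \<le> H" and r: "0 \<le> r"
  shows "prob {\<omega> \<in> space M. (\<Sum>k\<in>A. \<delta> k \<omega>) > u * sqrt (real H) * r} \<le> exp (- r\<^sup>2 / 2)"
proof -
  let ?G = "\<lambda>i (_ :: nat \<Rightarrow> real). of_bool (i \<in> A) :: real"
  let ?V = "\<Sum>i = 1..N. (of_bool (i \<in> A) :: real)\<^sup>2"
  have V: "?V = card A"
    using A(1) by (simp add: of_bool_def if_distrib[of "\<lambda>x. x\<^sup>2"] sum.If_cases Int_absorb1 Int_def[symmetric] cong: if_cong)
  have S: "(\<Sum>i = 1..N. \<delta> i \<omega> * of_bool (i \<in> A)) = (\<Sum>k\<in>A. \<delta> k \<omega>)" for \<omega>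
    using A(1) by (intro sum.mono_neutral_cong_right) auto
  have [measurable]: "random_variable borel (\<lambda>\<omega>. \<Sum>k\<in>A. \<delta> k \<omega>)"
    using A(1) by (intro borel_measurable_sum measurable_roundoff) auto
  have "u * sqrt (real (card A)) * r \<le> u * sqrt (real H) * r"
    using A(2) r u_pos by (intro mult_right_mono mult_left_mono) auto
  then have "prob {\<omega> \<in> space M. (\<Sum>k\<in>A. \<delta> k \<omega>) > u * sqrt (real H) * r}
      \<le> prob {\<omega> \<in> space M. (\<Sum>k\<in>A. \<delta> k \<omega>) > u * sqrt (card A) * r}"
    by (intro finite_measure_mono) auto
  also have "\<dots> \<le> exp (- r\<^sup>2 / 2)"
    using martingale_tail[where G = ?G and B = "\<lambda>i. of_bool (i \<in> A)", OF _ _ r] unfolding S V by simp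
  finally show ?thesis .
qed

text \<open>
  Here \<open>a i\<close> is the amount by which roundoff \<open>i\<close> is scaled when it is committed, and \<open>A i\<close> the set of
  operations through which it is then propagated.  The exceptional events on which some propagation
  factor is large account for the second summand of the failure probability.
\<close>

lemma propagated_error_tail:
  fixes a :: "nat \<Rightarrow> real" and A :: "nat \<Rightarrow> nat set"
  assumes u1: "u < 1"
    and A: "\<And>i. i \<in> {1..N} \<Longrightarrow> A i \<subseteq> {i<..N}" "\<And>i. i \<in> {1..N} \<Longrightarrow> card (A i) \<le> H"
    and r: "0 \<le> r" and L: "0 \<le> L"
  shows "prob {\<omega> \<in> space M. \<bar>\<Sum>i = 1..N. \<delta> i \<omega> * (a i * (\<Prod>k\<in>A i. 1 + \<delta> k \<omega>))\<bar>
            \<le> u * exp (L * sqrt (real H) * u) * sqrt (\<Sum>i = 1..N. (a i)\<^sup>2) * r}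
         \<ge> 1 - (2 * exp (- r\<^sup>2 / 2) + real N * exp (- L\<^sup>2 / 2))"
proof -
  define C where "C = exp (L * sqrt (real H) * u)"
  define T where "T = u * C * sqrt (\<Sum>i = 1..N. (a i)\<^sup>2) * r"
  define E where "E \<omega> = (\<Sum>i = 1..N. \<delta> i \<omega> * (a i * (\<Prod>k\<in>A i. 1 + \<delta> k \<omega>)))" for \<omega>
  \<comment> \<open>The truncated factors; truncation by the value of the product itself keeps them functions of
    the history, with a bound that holds everywhere.\<close>
  define G where "G i e = (let P = \<Prod>k\<in>A i. 1 + e k in if \<bar>P\<bar> \<le> C then a i * P else 0)"
    for i and e :: "nat \<Rightarrow> real"
  define S where "S \<omega> = (\<Sum>i = 1..N. \<delta> i \<omega> * G i (later i \<omega>))" for \<omega>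
  have A_sub: "A i \<subseteq> {1..N}" if "i \<in> {1..N}" for i
    using A(1)[OF that] that by auto
  have G_meas: "G i \<in> borel_measurable (Pi\<^sub>M {i<..N} (\<lambda>_. borel))" if i: "i \<in> {1..N}" for i
  proof -
    have [measurable]: "(\<lambda>e. \<Prod>k\<in>A i. 1 + e k) \<in> borel_measurable (Pi\<^sub>M {i<..N} (\<lambda>_. borel :: real measure))"
      using A(1)[OF i]
      by (intro borel_measurable_prod borel_measurable_add measurable_component_singleton) auto
    show ?thesis unfolding G_def Let_def by measurable
  qed
  have G_bound: "\<bar>G i e\<bar> \<le> \<bar>a i\<bar> * C" for i e
    by (auto simp: G_def Let_def abs_mult C_def intro: mult_left_mono)
  have V: "sqrt (\<Sum>i = 1..N. (\<bar>a i\<bar> * C)\<^sup>2) = C * sqrt (\<Sum>i = 1..N. (a i)\<^sup>2)"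
    by (simp add: power_mult_distrib sum_distrib_right[symmetric] real_sqrt_mult C_def)
  have S_meas [measurable]: "random_variable borel S"
    unfolding S_def using measurable_compose[OF measurable_later G_meas] measurable_roundoff
    by (intro borel_measurable_sum borel_measurable_times) auto
  have E_meas [measurable]: "random_variable borel E"
  proof -
    have "random_variable borel (\<delta> k)" if "i \<in> {1..N}" "k \<in> A i" for i k
      using A_sub[OF that(1)] that(2) by (intro measurable_roundoff) auto
    then show ?thesis
      unfolding E_def using measurable_roundoff
      by (intro borel_measurable_sum borel_measurable_times borel_measurable_prod borel_measurable_add) auto
  qed
  have upper: "prob {\<omega> \<in> space M. S \<omega> > T} \<le> exp (- r\<^sup>2 / 2)"
    using martingale_tail[where G = G and B = "\<lambda>i. \<bar>a i\<bar> * C", OF G_meas G_bound r]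
    unfolding S_def T_def V by (simp add: mult.assoc)
  have lower: "prob {\<omega> \<in> space M. - S \<omega> > T} \<le> exp (- r\<^sup>2 / 2)"
    using martingale_tail[where G = "\<lambda>i e. - G i e" and B = "\<lambda>i. \<bar>a i\<bar> * C", OF _ _ r] G_meas G_bound
    unfolding S_def T_def V by (simp add: mult.assoc sum_negf)
  define Q where "Q i = {\<omega> \<in> space M. (\<Sum>k\<in>A i. \<delta> k \<omega>) > u * sqrt (real H) * L}" for i
  have Q_prob: "prob (Q i) \<le> exp (- L\<^sup>2 / 2)" if "i \<in> {1..N}" for i
    unfolding Q_def using A(2)[OF that] A_sub[OF that] L by (intro sum_tail) auto
  have Q_event: "Q i \<in> events" if "i \<in> {1..N}" for i
  proof -
    have [measurable]: "random_variable borel (\<lambda>\<omega>. \<Sum>k\<in>A i. \<delta> k \<omega>)"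
      using A_sub[OF that] by (intro borel_measurable_sum measurable_roundoff) auto
    show ?thesis unfolding Q_def by measurable
  qed
  let ?U = "{\<omega> \<in> space M. S \<omega> > T} \<union> {\<omega> \<in> space M. - S \<omega> > T} \<union> (\<Union>i\<in>{1..N}. Q i)"
  have "prob {\<omega> \<in> space M. \<not> \<bar>E \<omega>\<bar> \<le> T} \<le> prob ?U"
  proof (rule finite_measure_mono_AE)
    show "AE \<omega> in M. \<omega> \<in> {\<omega> \<in> space M. \<not> \<bar>E \<omega>\<bar> \<le> T} \<longrightarrow> \<omega> \<in> ?U"
      using AE_all_le
    proof eventually_elim
      case (elim \<omega>)
      \<comment> \<open>Outside the exceptional events no product is truncated.\<close>
      have "E \<omega> = S \<omega>" if "\<omega> \<in> space M" "\<omega> \<notin> (\<Union>i\<in>{1..N}. Q i)"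
        unfolding E_def S_def
      proof (intro sum.cong refl)
        fix i assume i: "i \<in> {1..N}"
        let ?P = "\<Prod>k\<in>A i. 1 + \<delta> k \<omega>"
        have P: "(\<Prod>k\<in>A i. 1 + later i \<omega> k) = ?P"
          using A(1)[OF i] by (intro prod.cong) (auto simp: later_def)
        have nn: "0 \<le> 1 + \<delta> k \<omega>" if "k \<in> A i" for k
        proof -
          have "\<bar>\<delta> k \<omega>\<bar> \<le> u" using that elim A_sub[OF i] by blast
          then show ?thesis using u1 by linarith
        qed
        have "?P \<le> (\<Prod>k\<in>A i. exp (\<delta> k \<omega>))"
          using nn by (intro prod_mono) auto
        also have "\<dots> = exp (\<Sum>k\<in>A i. \<delta> k \<omega>)"
          using finite_subset[OF A_sub[OF i]] by (simp add: exp_sum)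
        also have "\<dots> \<le> C"
          using that i by (auto simp: Q_def C_def mult_ac not_less)
        finally have "\<bar>?P\<bar> \<le> C"
          using prod_nonneg[of "A i" "\<lambda>k. 1 + \<delta> k \<omega>"] nn by simp
        then show "\<delta> i \<omega> * (a i * ?P) = \<delta> i \<omega> * G i (later i \<omega>)"
          by (simp add: G_def P)
      qed
      then show ?case by auto
    qed
    show "?U \<in> events"
      using Q_event by (intro sets.Un sets.finite_UN) auto
  qed
  also have "\<dots> \<le> prob {\<omega> \<in> space M. S \<omega> > T} + prob {\<omega> \<in> space M. - S \<omega> > T} + prob (\<Union>i\<in>{1..N}. Q i)"
    using Q_event by (intro order_trans[OF measure_Un_le] add_mono sets.Un sets.finite_UN) auto
  also have "prob (\<Union>i\<in>{1..N}. Q i) \<le> (\<Sum>i\<in>{1..N}. prob (Q i))"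
    using Q_event by (intro finite_measure_subadditive_finite) auto
  also have "\<dots> \<le> (\<Sum>i\<in>{1..N}. exp (- L\<^sup>2 / 2))"
    by (intro sum_mono Q_prob)
  finally have "prob {\<omega> \<in> space M. \<not> \<bar>E \<omega>\<bar> \<le> T} \<le> 2 * exp (- r\<^sup>2 / 2) + real N * exp (- L\<^sup>2 / 2)"
    using upper lower by simp
  moreover have "prob {\<omega> \<in> space M. \<not> \<bar>E \<omega>\<bar> \<le> T} = 1 - prob {\<omega> \<in> space M. \<bar>E \<omega>\<bar> \<le> T}"
    by (rule prob_neg) measurable
  ultimately show ?thesis
    by (simp add: E_def T_def C_def)
qed

end

section \<open>Ancestors in the computational tree\<close>

text \<open>
  Steps only combine elements formed earlier, so this index decreases strictly along every edge; this
  makes the tree acyclic and its paths bounded.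
\<close>

primrec step_index :: "vertex \<Rightarrow> nat" where
  "step_index (Inp i) = 0"
| "step_index (Psum k) = k"

locale summation_tree =
  fixes n :: nat and \<sigma> :: schedule
  assumes n: "n \<ge> 2" and valid: "valid_schedule n \<sigma>"
begin

abbreviation edges :: "(vertex \<times> vertex) set" where
  "edges \<equiv> children n \<sigma>"

lemma child_in_pool:
  assumes "(Psum k, v) \<in> edges"
  shows "k \<in> {2..n}" "v \<in> pool n \<sigma> (k - 2)"
  using assms valid by (auto simp: children_def valid_schedule_def)

text \<open>
  An element that has been added up leaves the multiset and never returns, since every step inserts a
  fresh partial sum.  This is what makes the graph of \<open>children\<close> a tree.
\<close>

lemma child_not_in_later_pool:
  assumes edge: "(Psum k, v) \<in> edges" and "k - 1 \<le> j"
  shows "v \<notin> pool n \<sigma> j"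
proof -
  note k = child_in_pool[OF edge]
  have smaller: "v \<noteq> Psum m" if "k \<le> m" for m
    using k that pool_subset[of n \<sigma> "k - 2"] by auto
  from assms(2) show ?thesis
  proof (induction rule: dec_induct)
    case base
    have "k - 1 = Suc (k - 2)" "k - 2 + 2 = k" using k by auto
    then show ?case
      using smaller edge by (auto simp: children_def)
  next
    case (step j)
    then show ?case
      using smaller[of "j + 2"] by auto
  qed
qed

lemma parent_unique:
  assumes "(Psum k, v) \<in> edges" "(Psum m, v) \<in> edges"
  shows "k = m"
proof -
  have "\<not> k < m" if "(Psum k, v) \<in> edges" "(Psum m, v) \<in> edges" for k m
  proof
    assume "k < m"
    then have "k - 1 \<le> m - 2" by simp
    then show False
      using child_in_pool(2)[OF that(2)] child_not_in_later_pool[OF that(1)] by blast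
  qed
  then show ?thesis
    using assms by (meson linorder_neqE_nat)
qed

lemma step_index_less:
  assumes "(v, w) \<in> edges"
  shows "step_index w < step_index v"
proof -
  obtain k where v: "v = Psum k"
    using assms by (auto simp: children_def)
  note k = child_in_pool[OF assms[unfolded v]]
  have "w \<in> Inp ` {1..n} \<union> Psum ` {2..k - 2 + 1}"
    using k(2) pool_subset by blast
  then show ?thesis
    using k(1) v by auto
qed

lemma step_index_less_trancl: "(v, w) \<in> edges\<^sup>+ \<Longrightarrow> step_index w < step_index v"
  by (induction rule: trancl_induct) (auto dest: step_index_less)

lemma path_length_le_step_index: "(v, w) \<in> edges ^^ m \<Longrightarrow> m \<le> step_index v"
proof -
  have "m + step_index w \<le> step_index v" if "(v, w) \<in> edges ^^ m"
    using that by (induction m arbitrary: w) (auto dest!: step_index_less, fastforce)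
  then show "(v, w) \<in> edges ^^ m \<Longrightarrow> m \<le> step_index v" by simp
qed

text \<open>
  The steps whose partial sums lie strictly above \<open>v\<close>.
\<close>

definition anc :: "vertex \<Rightarrow> nat set" where
  "anc v = {k. (Psum k, v) \<in> edges\<^sup>+}"

lemma anc_subset: "anc v \<subseteq> {2..n}"
  by (auto simp: anc_def children_def dest!: tranclD)

lemma anc_greater: "m \<in> anc (Psum k) \<Longrightarrow> k < m"
  using step_index_less_trancl by (fastforce simp: anc_def)

lemma anc_root: "anc (Psum n) = {}"
  using anc_subset anc_greater by fastforce

lemma finite_anc: "finite (anc v)"
  using anc_subset finite_subset by blast

lemma anc_child:
  assumes "(Psum k, v) \<in> edges"
  shows "anc v = insert k (anc (Psum k))"
proof -
  have "(Psum m, v) \<in> edges\<^sup>+ \<longleftrightarrow> m = k \<or> (Psum m, Psum k) \<in> edges\<^sup>+" for m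
  proof
    assume "(Psum m, v) \<in> edges\<^sup>+"
    then obtain w where w: "(Psum m, w) \<in> edges\<^sup>*" "(w, v) \<in> edges"
      by (meson tranclD2)
    then obtain k' where "w = Psum k'" by (auto simp: children_def)
    with w parent_unique[OF assms] have "w = Psum k" by simp
    with w(1) show "m = k \<or> (Psum m, Psum k) \<in> edges\<^sup>+"
      by (auto simp: rtrancl_eq_or_trancl)
  qed (use assms in auto)
  then show ?thesis by (auto simp: anc_def)
qed

lemma finite_pool: "finite (pool n \<sigma> j)"
  by (induction j) auto

lemma step_children:
  assumes "j + 2 \<le> n"
  shows "fst (\<sigma> (j + 2)) \<in> pool n \<sigma> j" "snd (\<sigma> (j + 2)) \<in> pool n \<sigma> j"
    "fst (\<sigma> (j + 2)) \<noteq> snd (\<sigma> (j + 2))" "Psum (j + 2) \<notin> pool n \<sigma> j"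
    "(Psum (j + 2), fst (\<sigma> (j + 2))) \<in> edges" "(Psum (j + 2), snd (\<sigma> (j + 2))) \<in> edges"
proof -
  have k: "j + 2 \<in> {2..n}" "j + 2 - 2 = j" using assms by auto
  show "fst (\<sigma> (j + 2)) \<in> pool n \<sigma> j" "snd (\<sigma> (j + 2)) \<in> pool n \<sigma> j"
    "fst (\<sigma> (j + 2)) \<noteq> snd (\<sigma> (j + 2))"
    using valid k unfolding valid_schedule_def by metis+
  show "Psum (j + 2) \<notin> pool n \<sigma> j"
    using pool_subset[of n \<sigma> j] by auto
  show "(Psum (j + 2), fst (\<sigma> (j + 2))) \<in> edges" "(Psum (j + 2), snd (\<sigma> (j + 2))) \<in> edges"
    using assms by (auto simp: children_def)
qed

lemma card_pool: "j + 1 \<le> n \<Longrightarrow> card (pool n \<sigma> j) = n - j"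
proof (induction j)
  case 0
  then show ?case by (simp add: card_image inj_on_def)
next
  case (Suc j)
  note c = step_children[of j]
  have "card (pool n \<sigma> j - {fst (\<sigma> (j + 2)), snd (\<sigma> (j + 2))}) = n - j - 2"
    using Suc c by (simp add: card_Diff_subset finite_pool)
  then show ?case
    using Suc c finite_pool by (simp add: card_insert_if)
qed

text \<open>
  Every step reduces the number of elements by one, so only the element inserted last is left.
\<close>

lemma last_pool: "pool n \<sigma> (n - 1) = {Psum n}"
proof -
  have "n - 1 = Suc (n - 2)" "n - 2 + 2 = n" using n by auto
  then have "Psum n \<in> pool n \<sigma> (n - 1)" by simp
  moreover have "card (pool n \<sigma> (n - 1)) = 1" using card_pool[of "n - 1"] n by simp
  ultimately show ?thesis by (auto simp: card_1_singleton_iff)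
qed

text \<open>
  Parents are unique, so the strict ancestors of a vertex form the path to it from the root, one edge
  for each of them.  The induction runs backwards through the schedule, from the pool \<open>{Psum n}\<close>.
\<close>

lemma path_from_root:
  assumes "j \<le> n - 1" "v \<in> pool n \<sigma> j"
  shows "(Psum n, v) \<in> edges ^^ card (anc v)"
  using assms
proof (induction arbitrary: v rule: inc_induct)
  case base
  then show ?case using last_pool by (simp add: anc_root del: One_nat_def)
next
  case (step j)
  show ?case
  proof (cases "v = fst (\<sigma> (j + 2)) \<or> v = snd (\<sigma> (j + 2))")
    case True
    then have edge: "(Psum (j + 2), v) \<in> edges"
      using step_children[of j] step.hyps by auto
    moreover have "j + 2 \<notin> anc (Psum (j + 2))"
      using anc_greater by blast
    ultimately have "card (anc v) = Suc (card (anc (Psum (j + 2))))"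
      by (simp add: anc_child finite_anc)
    moreover have "(Psum n, Psum (j + 2)) \<in> edges ^^ card (anc (Psum (j + 2)))"
      by (intro step.IH) simp
    ultimately show ?thesis
      using edge by auto
  next
    case False
    then show ?thesis
      using step.prems by (intro step.IH) auto
  qed
qed

lemma path_to_input:
  assumes "j \<le> n - 1" "v \<in> pool n \<sigma> j"
  shows "\<exists>m. \<exists>i\<in>{1..n}. (v, Inp i) \<in> edges ^^ m"
  using assms
proof (induction j arbitrary: v)
  case 0
  then obtain i where "i \<in> {1..n}" "(v, Inp i) \<in> edges ^^ 0" by auto
  then show ?case by blast
next
  case (Suc j)
  show ?case
  proof (cases "v = Psum (j + 2)")
    case True
    have j: "j + 2 \<le> n" "j \<le> n - 1"
      using Suc.prems(1) n by auto
    note c = step_children[OF j(1)]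
    obtain m i where "i \<in> {1..n}" "(fst (\<sigma> (j + 2)), Inp i) \<in> edges ^^ m"
      using Suc.IH[OF j(2) c(1)] by blast
    moreover have "(v, fst (\<sigma> (j + 2))) \<in> edges"
      using True c(5) by simp
    ultimately show ?thesis
      by (meson relpow_Suc_I2)
  next
    case False
    then show ?thesis
      using Suc by auto
  qed
qed

text \<open>
  The path from the root down to \<open>v\<close> extends to an input, and so is no longer than the height.
\<close>

lemma card_anc_le_height:
  assumes "j \<le> n - 1" "v \<in> pool n \<sigma> j"
  shows "card (anc v) \<le> tree_height n \<sigma>"
proof -
  obtain m i where "i \<in> {1..n}" "(v, Inp i) \<in> edges ^^ m"
    using path_to_input[OF assms] by blast
  then have "(Psum n, Inp i) \<in> edges ^^ (card (anc v) + m)" "i \<in> {1..n}"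
    using path_from_root[OF assms] by (auto simp: relpow_add)
  moreover have "finite {m. \<exists>i\<in>{1..n}. (Psum n, Inp i) \<in> edges ^^ m}"
    by (rule finite_subset[of _ "{..step_index (Psum n)}"]) (auto dest: path_length_le_step_index)
  ultimately have "card (anc v) + m \<le> tree_height n \<sigma>"
    unfolding tree_height_def by (intro Max_ge) auto
  then show ?thesis by simp
qed

section \<open>Propagation of the roundoffs to the root\<close>

text \<open>
  The final error is a linear functional of the errors in any intermediate pool, with weight \<open>W v\<close> for
  the element \<open>v\<close>, plus the contributions of the steps that follow.  Undoing the steps one at a time
  replaces the error in a partial sum by those in its two children and its own roundoff.
\<close>

lemma error_expansion:
  fixes \<rho> :: "nat \<Rightarrow> real" and y z :: "nat \<Rightarrow> real"
  defines "ex \<equiv> vertex_value (\<lambda>_ a b. a + b) n \<sigma> y"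
    and "fl \<equiv> vertex_value (\<lambda>k a b. (a + b) * (1 + \<rho> k)) n \<sigma> z"
    and "W \<equiv> \<lambda>v. \<Prod>k\<in>anc v. 1 + \<rho> k"
  shows "fl (Psum n) - ex (Psum n) =
    (\<Sum>i = 1..n. W (Inp i) * (z i - y i)) + (\<Sum>k = 2..n. W (Psum k) * (\<rho> k * ex (Psum k)))"
proof -
  have "fl (Psum n) - ex (Psum n) =
      (\<Sum>v\<in>pool n \<sigma> j. W v * (fl v - ex v)) + (\<Sum>k = j + 2..n. W (Psum k) * (\<rho> k * ex (Psum k)))"
    if "j \<le> n - 1" for j
    using that
  proof (induction rule: inc_induct)
    case base
    then show ?case using n last_pool by (simp add: W_def anc_root del: One_nat_def)
  next
    case (step j)
    let ?a = "fst (\<sigma> (j + 2))" and ?b = "snd (\<sigma> (j + 2))" and ?p = "Psum (j + 2)"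
    let ?g = "\<lambda>v. W v * (fl v - ex v)"
    have k: "j + 2 \<in> {2..n}" using step.hyps by auto
    have "j + 2 \<le> n" using k by simp
    note c = step_children[OF this]
    have W: "W v = (1 + \<rho> (j + 2)) * W ?p" if "(?p, v) \<in> edges" for v
    proof -
      have "j + 2 \<notin> anc ?p"
        using anc_greater by blast
      then show ?thesis
        by (simp add: W_def anc_child[OF that] finite_anc)
    qed
    have vals: "ex ?p = ex ?a + ex ?b" "fl ?p = (fl ?a + fl ?b) * (1 + \<rho> (j + 2))"
      unfolding ex_def fl_def by (simp_all only: vertex_value_Psum[OF valid k])
    have weights: "W ?a = (1 + \<rho> (j + 2)) * W ?p" "W ?b = (1 + \<rho> (j + 2)) * W ?p"
      using W c(5,6) by blast+
    have local: "?g ?p = ?g ?a + ?g ?b + W ?p * (\<rho> (j + 2) * ex ?p)"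
      unfolding vals weights by (simp add: algebra_simps)
    \<comment> \<open>The step exchanges the two children for their sum; the rest of the pool is untouched.\<close>
    have "sum ?g (pool n \<sigma> (Suc j)) = ?g ?p + sum ?g (pool n \<sigma> j - {?a, ?b})"
      using c(4) finite_pool by (simp del: add_2_eq_Suc')
    moreover have "sum ?g (pool n \<sigma> j) = ?g ?a + ?g ?b + sum ?g (pool n \<sigma> j - {?a, ?b})"
      using c(1-3) sum.subset_diff[of "{?a, ?b}" "pool n \<sigma> j" ?g] finite_pool
      by (simp del: add_2_eq_Suc')
    moreover have "{j + 2..n} = insert (j + 2) {Suc j + 2..n}"
      using k by auto
    ultimately show ?case
      using step.IH local by (simp del: add_2_eq_Suc' pool.simps)
  qed
  from this[of 0] show ?thesis
    by (simp add: sum.reindex inj_on_def ex_def fl_def vertex_value_Inp numeral_2_eq_2)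
qed

text \<open>
  The operations are the \<open>n\<close> shifts, the inner additions and the final addition, numbered in this
  order.
\<close>

lemma sum_operations:
  fixes g :: "nat \<Rightarrow> real"
  shows "(\<Sum>i = 1..2 * n. g i) = (\<Sum>i = 1..n. g i) + (\<Sum>k = 2..n. g (n + k - 1)) + g (2 * n)"
proof -
  have image: "(\<lambda>k. n + k - 1) ` {2..n} = {n + 1..2 * n - 1}"
  proof (intro equalityI subsetI)
    fix i assume "i \<in> {n + 1..2 * n - 1}"
    then show "i \<in> (\<lambda>k. n + k - 1) ` {2..n}"
      by (intro image_eqI[of _ _ "i + 1 - n"]) auto
  qed auto
  have "(\<Sum>k = 2..n. g (n + k - 1)) = (\<Sum>i = n + 1..2 * n - 1. g i)"
    unfolding image[symmetric] by (subst sum.reindex) (auto simp: inj_on_def)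
  moreover have "{1..2 * n} = insert (2 * n) ({1..n} \<union> {n + 1..2 * n - 1})"
    using n by auto
  moreover have "sum g ({1..n} \<union> {n + 1..2 * n - 1}) = sum g {1..n} + sum g {n + 1..2 * n - 1}"
    by (rule sum.union_disjoint) auto
  ultimately show ?thesis
    using n by simp
qed

text \<open>
  The vertex that operation \<open>i < 2 * n\<close> produces.  The final addition lies outside the inner tree and
  is treated separately below.
\<close>

definition op_vertex :: "nat \<Rightarrow> vertex" where
  "op_vertex i = (if i \<le> n then Inp i else Psum (i + 1 - n))"

text \<open>
  The operations that the result of operation \<open>i\<close> passes through: the additions above it in the inner
  tree and the final addition.
\<close>

definition anc_ops :: "nat \<Rightarrow> nat set" where
  "anc_ops i = (if i = 2 * n then {} else insert (2 * n) ((\<lambda>k. n + k - 1) ` anc (op_vertex i)))"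

definition op_result :: "(nat \<Rightarrow> real) \<Rightarrow> real \<Rightarrow> nat \<Rightarrow> real" where
  "op_result x c i =
     (if i = 2 * n then shifted_s n \<sigma> x c
      else if i \<le> n then shifted_y x c i else shifted_t n \<sigma> x c (i + 1 - n))"

lemma op_indices:
  "i \<in> {1..n} \<Longrightarrow> i \<noteq> 2 * n \<and> op_vertex i = Inp i"
  "k \<in> {2..n} \<Longrightarrow> n + k - 1 \<noteq> 2 * n \<and> \<not> n + k - 1 \<le> n \<and> n + k - 1 + 1 - n = k"
  using n by (auto simp: op_vertex_def)

lemma op_vertex_Psum: "k \<in> {2..n} \<Longrightarrow> op_vertex (n + k - 1) = Psum k"
  using op_indices(2)[of k] by (simp only: op_vertex_def if_False)

lemma anc_ops_subset:
  assumes "i \<in> {1..2 * n}"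
  shows "anc_ops i \<subseteq> {i<..2 * n}"
proof (cases "i = 2 * n")
  case False
  have "i < n + k - 1 \<and> n + k - 1 \<le> 2 * n" if "k \<in> anc (op_vertex i)" for k
  proof -
    have k: "k \<in> {2..n}"
      using that anc_subset by blast
    show ?thesis
    proof (cases "i \<le> n")
      case True
      then show ?thesis using k by auto
    next
      case False
      then have "i + 1 - n < k"
        using that anc_greater[of k "i + 1 - n"] by (simp add: op_vertex_def)
      then show ?thesis using k by auto
    qed
  qed
  then show ?thesis
    using False assms by (auto simp: anc_ops_def)
qed (simp add: anc_ops_def)

lemma card_anc_ops:
  assumes "i \<in> {1..2 * n}"
  shows "card (anc_ops i) \<le> tree_height n \<sigma> + 1"
proof (cases "i = 2 * n")
  case False
  have "card (anc (op_vertex i)) \<le> tree_height n \<sigma>"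
  proof (cases "i \<le> n")
    case True
    then show ?thesis
      using assms by (intro card_anc_le_height[of 0]) (auto simp: op_vertex_def)
  next
    case i: False
    \<comment> \<open>The partial sum \<open>Psum (j + 2)\<close> enters the pool in step number \<open>j + 1\<close>.\<close>
    then obtain j where j: "i = n + Suc j"
      using less_imp_Suc_add[of n i] by auto
    then have "op_vertex i = Psum (j + 2)"
      by (simp add: op_vertex_def)
    moreover have "Suc j \<le> n - 1"
      using j assms False by auto
    ultimately show ?thesis
      by (intro card_anc_le_height[of "Suc j"]) auto
  qed
  then have "card ((\<lambda>k. n + k - 1) ` anc (op_vertex i)) \<le> tree_height n \<sigma>"
    using card_image_le[OF finite_anc] order_trans by blast
  then show ?thesis
    using False finite_anc by (simp add: anc_ops_def card_insert_if)
qed (simp add: anc_ops_def)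

lemma prod_anc_ops:
  fixes e :: "nat \<Rightarrow> real"
  assumes "i \<noteq> 2 * n"
  shows "(\<Prod>k\<in>anc_ops i. 1 + e k) =
    (1 + e (2 * n)) * (\<Prod>k\<in>anc (op_vertex i). 1 + e (n + k - 1))"
proof -
  have "inj_on (\<lambda>k. n + k - 1) (anc (op_vertex i))" "2 * n \<notin> (\<lambda>k. n + k - 1) ` anc (op_vertex i)"
    using anc_subset[of "op_vertex i"] n by (fastforce simp: inj_on_def)+
  then show ?thesis
    using assms by (simp add: anc_ops_def finite_anc prod.reindex)
qed

lemma shifted_error_expansion:
  "fl_shifted_s e n \<sigma> x c - shifted_s n \<sigma> x c =
     (\<Sum>i = 1..2 * n. e i * (op_result x c i * (\<Prod>k\<in>anc_ops i. 1 + e k)))"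
proof -
  define W where "W v = (\<Prod>k\<in>anc v. 1 + e (n + k - 1))" for v
  have inner: "fl_shifted_t e n \<sigma> x c n - shifted_t n \<sigma> x c n =
      (\<Sum>i = 1..n. W (Inp i) * (shifted_y x c i * e i)) +
      (\<Sum>k = 2..n. W (Psum k) * (e (n + k - 1) * shifted_t n \<sigma> x c k))"
    unfolding fl_shifted_t_def shifted_t_def W_def
    by (subst error_expansion[where \<rho> = "\<lambda>k. e (n + k - 1)"])
       (simp add: fl_shifted_y_def shifted_y_def algebra_simps)
  have "(\<Sum>i = 1..n. e i * (op_result x c i * (\<Prod>k\<in>anc_ops i. 1 + e k))) =
      (1 + e (2 * n)) * (\<Sum>i = 1..n. W (Inp i) * (shifted_y x c i * e i))"
    unfolding sum_distrib_left
  proof (intro sum.cong refl)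
    fix i assume i: "i \<in> {1..n}"
    then have "op_result x c i = shifted_y x c i"
      using n by (simp add: op_result_def)
    then show "e i * (op_result x c i * (\<Prod>k\<in>anc_ops i. 1 + e k)) =
        (1 + e (2 * n)) * (W (Inp i) * (shifted_y x c i * e i))"
      using op_indices(1)[OF i] by (simp add: prod_anc_ops W_def)
  qed
  moreover have "(\<Sum>k = 2..n. e (n + k - 1) *
        (op_result x c (n + k - 1) * (\<Prod>m\<in>anc_ops (n + k - 1). 1 + e m))) =
      (1 + e (2 * n)) * (\<Sum>k = 2..n. W (Psum k) * (e (n + k - 1) * shifted_t n \<sigma> x c k))"
    unfolding sum_distrib_left
  proof (intro sum.cong refl)
    fix k assume k: "k \<in> {2..n}"
    have "op_result x c (n + k - 1) = shifted_t n \<sigma> x c k"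
      using op_indices(2)[OF k] by (simp only: op_result_def if_False)
    moreover have "(\<Prod>m\<in>anc_ops (n + k - 1). 1 + e m) = (1 + e (2 * n)) * W (Psum k)"
      unfolding prod_anc_ops[OF conjunct1[OF op_indices(2)[OF k]]] op_vertex_Psum[OF k] W_def ..
    ultimately show "e (n + k - 1) * (op_result x c (n + k - 1) * (\<Prod>m\<in>anc_ops (n + k - 1). 1 + e m)) =
        (1 + e (2 * n)) * (W (Psum k) * (e (n + k - 1) * shifted_t n \<sigma> x c k))"
      by simp
  qed
  moreover have "e (2 * n) * (op_result x c (2 * n) * (\<Prod>k\<in>anc_ops (2 * n). 1 + e k)) =
      e (2 * n) * shifted_s n \<sigma> x c"
    by (simp add: op_result_def anc_ops_def)
  moreover have "fl_shifted_s e n \<sigma> x c - shifted_s n \<sigma> x c =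
      (1 + e (2 * n)) * (fl_shifted_t e n \<sigma> x c n - shifted_t n \<sigma> x c n) + e (2 * n) * shifted_s n \<sigma> x c"
    by (simp add: fl_shifted_s_def shifted_s_def algebra_simps)
  ultimately show ?thesis
    unfolding sum_operations inner by (simp only: distrib_left)
qed

lemma sum_op_result_squares:
  "(\<Sum>i = 1..2 * n. (op_result x c i)\<^sup>2) =
     (shifted_s n \<sigma> x c)\<^sup>2 + (\<Sum>k = 2..n. (shifted_t n \<sigma> x c k)\<^sup>2) + (\<Sum>k = 1..n. (shifted_y x c k)\<^sup>2)"
proof -
  have "op_result x c i = shifted_y x c i" if "i \<in> {1..n}" for i
    using that n by (simp add: op_result_def)
  moreover have "op_result x c (n + k - 1) = shifted_t n \<sigma> x c k" if "k \<in> {2..n}" for k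
    using op_indices(2)[OF that] by (simp only: op_result_def if_False)
  ultimately show ?thesis
    unfolding sum_operations by (simp add: op_result_def[of x c "2 * n"])
qed

end

section \<open>The error bound\<close>

theorem theorem3p4:
  fixes M :: "'w measure" and \<delta> :: "nat \<Rightarrow> 'w \<Rightarrow> real"
    and n h :: nat and \<sigma> :: schedule
    and x :: "nat \<Rightarrow> real" and c u \<eta> p lam :: real
  assumes "prob_space M"
    and "n \<ge> 2"
    and "valid_schedule n \<sigma>"
    and "0 < u" and "u < 1"
    and "prob_space.indep_vars M (\<lambda>_. borel) \<delta> {1..2 * n}"
    and "\<And>k. k \<in> {1..2 * n} \<Longrightarrow> prob_space.expectation M (\<delta> k) = 0"
    and "\<And>k. k \<in> {1..2 * n} \<Longrightarrow> AE \<omega> in M. \<bar>\<delta> k \<omega>\<bar> \<le> u"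
    and "h = tree_height n \<sigma>"
    and "lam = sqrt (2 * ln (2 * (2 * real n + 1) / \<eta>))"
    and "\<eta> > 0" and "lam * sqrt (real h + 2) * u < 1"
    and "0 < p" and "p < 1"
  shows "measure M {\<omega> \<in> space M.
           \<bar>fl_shifted_s (\<lambda>k. \<delta> k \<omega>) n \<sigma> x c - shifted_s n \<sigma> x c\<bar>
             \<le> u * exp (lam * sqrt (real h + 2) * u)
                 * sqrt ((shifted_s n \<sigma> x c)\<^sup>2 + (\<Sum>k = 2..n. (shifted_t n \<sigma> x c k)\<^sup>2)
                         + (\<Sum>k = 1..n. (shifted_y x c k)\<^sup>2))
                 * sqrt (2 * ln (2 / p))}
         \<ge> 1 - (p + \<eta>)"
proof (cases "\<eta> < 1")
  case False
  \<comment> \<open>The claim is void, and \<open>lam\<close> may fail to be the root of a nonnegative number.\<close>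
  then have "1 - (p + \<eta>) \<le> 0"
    using \<open>0 < p\<close> by simp
  then show ?thesis
    by (rule order_trans) (rule measure_nonneg)
next
  case True
  interpret prob_space M by fact
  interpret bounded_roundoffs M \<delta> "2 * n" u
    by unfold_locales (use assms(4,6-8) in auto)
  interpret summation_tree n \<sigma>
    by unfold_locales fact+
  define r where "r = sqrt (2 * ln (2 / p))"
  have "0 \<le> ln (2 / p)"
    using assms(13,14) by simp
  then have r: "0 \<le> r" "2 * exp (- r\<^sup>2 / 2) = p"
    using assms(13) by (simp_all add: r_def exp_minus)
  have arg: "1 \<le> 2 * (2 * real n + 1) / \<eta>"
    using True \<open>\<eta> > 0\<close> by (simp add: field_simps)
  then have "0 \<le> ln (2 * (2 * real n + 1) / \<eta>)"
    by (rule ln_ge_zero)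
  then have lam: "0 \<le> lam" "- lam\<^sup>2 / 2 = - ln (2 * (2 * real n + 1) / \<eta>)"
    using assms(10) by simp_all
  \<comment> \<open>The union bound over the \<open>2 * n\<close> operations costs at most \<open>\<eta>\<close>.\<close>
  have "real (2 * n) * exp (- lam\<^sup>2 / 2) = \<eta> * (real n / (2 * real n + 1))"
    unfolding lam(2) using arg \<open>\<eta> > 0\<close> by (simp add: exp_minus field_simps)
  also have "\<dots> \<le> \<eta> * 1"
    using \<open>\<eta> > 0\<close> by (intro mult_left_mono) (auto simp: field_simps)
  finally have eta: "real (2 * n) * exp (- lam\<^sup>2 / 2) \<le> \<eta>"
    by simp
  have tail: "1 - (2 * exp (- r\<^sup>2 / 2) + real (2 * n) * exp (- lam\<^sup>2 / 2)) \<le>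
    prob {\<omega> \<in> space M. \<bar>fl_shifted_s (\<lambda>k. \<delta> k \<omega>) n \<sigma> x c - shifted_s n \<sigma> x c\<bar>
      \<le> u * exp (lam * sqrt (real (h + 2)) * u) * sqrt (\<Sum>i = 1..2 * n. (op_result x c i)\<^sup>2) * r}"
    unfolding shifted_error_expansion assms(9)
  proof (rule propagated_error_tail)
    fix i assume "i \<in> {1..2 * n}"
    then show "card (anc_ops i) \<le> tree_height n \<sigma> + 2"
      using card_anc_ops[of i] by simp
  qed (use assms(5) r lam anc_ops_subset in auto)
  have "1 - (p + \<eta>) \<le> 1 - (2 * exp (- r\<^sup>2 / 2) + real (2 * n) * exp (- lam\<^sup>2 / 2))"
    using r(2) eta by linarith
  also note tail
  also have "real (h + 2) = real h + 2"
    by simp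
  finally show ?thesis
    unfolding sum_op_result_squares r_def .
qed

end
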